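(* Let $X$ be a real Banach space. Let $A:D(A)\to 2^X$ with $0\in Aq$ be uniformly accretive at zero with modulus $\Theta$, and in addition suppose that $A$ has a modulus of uniform continuity $\varpi:(0,\infty)\to(0,\infty)$. Assume that $R(I-A)$ is bounded. Let $(\alpha_n),(\beta_n)$ be sequences in $[0,\tfrac12)$ such that $\alpha_n,\beta_n\to 0$ with joint rate of convergence $\phi$ and $\sum_{i=0}^\infty\alpha_i=\infty$ with rate of divergence $r$. Suppose that $(x_n),(y_n),(u_n)$ and $(v_n)$ are sequences satisfying, for all $n\in\mathbb{N}$, $x_n,y_n\in D(A)$ and $$\begin{aligned}x_{n+1}&=(1-\alpha_n)x_n+\alpha_nu_n,\qquad u_n\in(I-A)y_n,\\ y_n&=(1-\beta_n)x_n+\beta_nv_n,\qquad v_n\in(I-A)x_n.\end{aligned}$$ Finally, suppose that $K_0,K_1\in(0,\infty)$ satisfy $\|w\|<K_0$ for all $w\in R(I-A)$ and $\|x_0-q\|<K_1$. Then $\|x_n-q\|\to 0$ as $n\to\infty$ with rate of convergence $$\Phi_{\Theta,\varpi,\phi,r,K_0,K_1}(\varepsilon):=r\left(\phi\left(\min\left\{\frac14,\frac{1}{6K}\min\left\{\frac{\Theta_K(\varepsilon)}{16K},\varpi\left(\frac{\Theta_K(\varepsilon)}{16K}\right)\right\}\right\}\right),\frac{K^2}{\Theta_K(\varepsilon)}\right)+1$$ for $K:=2K_0+K_1$.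
   Context: $\mathbb{N}=\{0,1,2,\ldots\}$. $X$ is a real Banach space with dual $X^\ast$; the normalized duality mapping $J:X\to 2^{X^\ast}$ is $J(x):=\{j\in X^\ast : \langle x,j\rangle=\|x\|^2=\|j\|^2\}$. An operator on $X$ is a mapping $A:X\to 2^X$, with domain $D(A):=\{x\in X: Ax\neq\emptyset\}$ and range $R(A):=\{y\in X:\exists x\in X\,(y\in Ax)\}$; $(x,u)\in A$ means $u\in Ax$. $(I-A)x=\{x-u: u\in Ax\}$. $A$ is accretive if for all $u\in Ax$ and $v\in Ay$ there exists $j\in J(x-y)$ with $\langle u-v,j\rangle\geq 0$. An accretive operator $A:D(A)\to 2^X$ with $0\in Aq$ is uniformly accretive at zero if for all $\varepsilon,K>0$ there exists $\delta>0$ such that $$(\ast)\quad \forall (x,u)\in A\ \big(\|x-q\|\in[\varepsilon,K]\to \exists j\in J(x-q)\ (\langle u,j\rangle\geq\delta)\big).$$ A function $\Theta_{(\cdot)}(\cdot):(0,\infty)\times(0,\infty)\to(0,\infty)$ such that $\delta:=\Theta_K(\varepsilon)$ satisfies $(\ast)$ for all $\varepsilon,K>0$ is called a modulus of uniform accretivity at zero for $A$. For $P,Q\subseteq X$ and $a>0$, $H^\ast[P,Q,a]$ means: $\forall u\in P\ \exists v\in Q\ (\|u-v\|\leq a)$. A modulus of uniform continuity for $A:D(A)\to 2^X$ is a function $\varpi:(0,\infty)\to(0,\infty)$ with $$\forall\varepsilon>0\ \forall x,y\in D(A)\ \big(\|x-y\|\leq\varpi(\varepsilon)\to H^\ast[Ax,Ay,\varepsilon]\big).$$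 A rate of convergence for a sequence of nonnegative reals $a_n\to 0$ is a function $\phi:(0,\infty)\to\mathbb{N}$ with $\forall\varepsilon>0\ \forall n\geq\phi(\varepsilon)\ (a_n\leq\varepsilon)$. A joint rate of convergence for $\alpha_n,\beta_n\to0$ is a function which is a rate of convergence for both sequences. A rate of divergence for $\sum_{i=0}^\infty\alpha_i=\infty$ (with $\alpha_i\ge 0$) is a function $r:\mathbb{N}\times(0,\infty)\to\mathbb{N}$ with $\sum_{i=N}^{r(N,x)}\alpha_i\geq x$ for all $N\in\mathbb{N}$, $x>0$, where $\sum_{i=N}^m\alpha_i=0$ if $m<N$. *)

theory Defs
  imports "HOL-Analysis.Analysis"
begin

text \<open>
  A set-valued operator on \<open>X\<close> is a function \<open>'a \<Rightarrow> 'a set\<close>, where \<open>(x,u) \<in> A\<close> is read as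
  \<open>u \<in> A x\<close>. Functions with domain \<open>(0,\<infinity>)\<close> are total functions on \<open>real\<close> which are only
  constrained at positive arguments. The dual of \<open>X\<close> is the type of bounded linear functionals
  with the operator norm.
\<close>

definition op_domain :: "('a \<Rightarrow> 'b set) \<Rightarrow> 'a set" where
  "op_domain A = {x. A x \<noteq> {}}"

definition op_range :: "('a \<Rightarrow> 'b set) \<Rightarrow> 'b set" where
  "op_range A = {y. \<exists>x. y \<in> A x}"

definition id_minus :: "('a::real_normed_vector \<Rightarrow> 'a set) \<Rightarrow> 'a \<Rightarrow> 'a set" where
  "id_minus A x = {x - u | u. u \<in> A x}"

definition duality_map :: "'a::real_normed_vector \<Rightarrow> ('a \<Rightarrow>\<^sub>L real) set" where
  "duality_map x = {j. blinfun_apply j x = (norm x)\<^sup>2 \<and> (norm x)\<^sup>2 = (norm j)\<^sup>2}"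

definition accretive :: "('a::real_normed_vector \<Rightarrow> 'a set) \<Rightarrow> bool" where
  "accretive A \<longleftrightarrow>
     (\<forall>x y. \<forall>u\<in>A x. \<forall>v\<in>A y. \<exists>j\<in>duality_map (x - y). blinfun_apply j (u - v) \<ge> 0)"

definition accretivity_bound ::
    "('a::real_normed_vector \<Rightarrow> 'a set) \<Rightarrow> 'a \<Rightarrow> real \<Rightarrow> real \<Rightarrow> real \<Rightarrow> bool" where
  "accretivity_bound A q \<epsilon> K \<delta> \<longleftrightarrow>
     (\<forall>x. \<forall>u\<in>A x. norm (x - q) \<in> {\<epsilon>..K} \<longrightarrow>
        (\<exists>j\<in>duality_map (x - q). blinfun_apply j u \<ge> \<delta>))"

definition uniformly_accretive_at_zero ::
    "('a::real_normed_vector \<Rightarrow> 'a set) \<Rightarrow> 'a \<Rightarrow> bool" where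
  "uniformly_accretive_at_zero A q \<longleftrightarrow>
     accretive A \<and> 0 \<in> A q \<and> (\<forall>\<epsilon>>0. \<forall>K>0. \<exists>\<delta>>0. accretivity_bound A q \<epsilon> K \<delta>)"

text \<open>The subscript of the modulus comes first: \<open>\<Theta> K \<epsilon>\<close> stands for \<open>\<Theta>\<^sub>K(\<epsilon>)\<close>.\<close>

definition modulus_accretivity_at_zero ::
    "(real \<Rightarrow> real \<Rightarrow> real) \<Rightarrow> ('a::real_normed_vector \<Rightarrow> 'a set) \<Rightarrow> 'a \<Rightarrow> bool" where
  "modulus_accretivity_at_zero \<Theta> A q \<longleftrightarrow>
     (\<forall>\<epsilon>>0. \<forall>K>0. \<Theta> K \<epsilon> > 0 \<and> accretivity_bound A q \<epsilon> K (\<Theta> K \<epsilon>))"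

definition Hstar :: "'a::real_normed_vector set \<Rightarrow> 'a set \<Rightarrow> real \<Rightarrow> bool" where
  "Hstar P Q a \<longleftrightarrow> (\<forall>u\<in>P. \<exists>v\<in>Q. norm (u - v) \<le> a)"

definition modulus_uniform_continuity ::
    "(real \<Rightarrow> real) \<Rightarrow> ('a::real_normed_vector \<Rightarrow> 'a set) \<Rightarrow> bool" where
  "modulus_uniform_continuity \<omega> A \<longleftrightarrow>
     (\<forall>\<epsilon>>0. \<omega> \<epsilon> > 0 \<and>
        (\<forall>x\<in>op_domain A. \<forall>y\<in>op_domain A. norm (x - y) \<le> \<omega> \<epsilon> \<longrightarrow> Hstar (A x) (A y) \<epsilon>))"

definition rate_of_convergence :: "(real \<Rightarrow> nat) \<Rightarrow> (nat \<Rightarrow> real) \<Rightarrow> bool" where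
  "rate_of_convergence \<phi> a \<longleftrightarrow> (\<forall>\<epsilon>>0. \<forall>n\<ge>\<phi> \<epsilon>. a n \<le> \<epsilon>)"

definition joint_rate_of_convergence ::
    "(real \<Rightarrow> nat) \<Rightarrow> (nat \<Rightarrow> real) \<Rightarrow> (nat \<Rightarrow> real) \<Rightarrow> bool" where
  "joint_rate_of_convergence \<phi> a b \<longleftrightarrow> rate_of_convergence \<phi> a \<and> rate_of_convergence \<phi> b"

definition rate_of_divergence :: "(nat \<Rightarrow> real \<Rightarrow> nat) \<Rightarrow> (nat \<Rightarrow> real) \<Rightarrow> bool" where
  "rate_of_divergence r a \<longleftrightarrow> (\<forall>N. \<forall>x>0. (\<Sum>i=N..r N x. a i) \<ge> x)"

definition Phi_rate ::
    "(real \<Rightarrow> real \<Rightarrow> real) \<Rightarrow> (real \<Rightarrow> real) \<Rightarrow> (real \<Rightarrow> nat) \<Rightarrow> (nat \<Rightarrow> real \<Rightarrow> nat)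
      \<Rightarrow> real \<Rightarrow> real \<Rightarrow> real \<Rightarrow> nat" where
  "Phi_rate \<Theta> \<omega> \<phi> r K\<^sub>0 K\<^sub>1 \<epsilon> =
     (let K = 2 * K\<^sub>0 + K\<^sub>1 in
        r (\<phi> (min (1 / 4)
                  (1 / (6 * K) * min (\<Theta> K \<epsilon> / (16 * K)) (\<omega> (\<Theta> K \<epsilon> / (16 * K))))))
          (K\<^sup>2 / \<Theta> K \<epsilon>) + 1)"

end

theory Submission imports Defs begin

text \<open>
  Write \<open>d n = norm (x n - q)\<close> and \<open>\<delta> = \<Theta> K \<epsilon>\<close>. Since \<open>q\<close> itself lies in the range of \<open>I - A\<close>,
  convexity keeps \<open>d n < K\<close>. For \<open>n\<close> beyond the index given by \<open>\<phi>\<close>, the points \<open>y n\<close> and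
  \<open>x (n + 1)\<close> are so close that the element of \<open>A (y n)\<close> used by the scheme can be replaced by one
  of \<open>A (x (n + 1))\<close>. If \<open>d (n + 1) > \<epsilon>\<close>, testing the recursion against the functional provided by
  uniform accretivity at \<open>x (n + 1)\<close> then yields \<open>d (n + 1)\<^sup>2 \<le> d n\<^sup>2 - \<alpha> n * \<delta>\<close>. In particular \<open>d\<close>
  never exceeds \<open>\<epsilon>\<close> again once it is below it, and by divergence of the sum of \<open>\<alpha>\<close> the decrease of
  \<open>d\<^sup>2 < K\<^sup>2\<close> has to stop.
\<close>

lemma duality_map_apply_le:
  assumes "j \<in> duality_map z"
  shows "blinfun_apply j w \<le> norm z * norm w"
proof -
  have "norm j = norm z"
    using assms by (simp add: duality_map_def)
  then show ?thesis
    using norm_blinfun[of j w] by simp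
qed

text \<open>Apply \<open>j\<close> to a convex splitting of \<open>z - q\<close>: the errors
  \<open>y - z\<close> and \<open>c - a\<close> cost at most half of the gain \<delta> from
  \<open>c\<close>, and the cross term \<open>norm (z - q) * norm (x - q)\<close> is bounded by the
  mean of the squares. Doubling the resulting inequality turns the remaining \<delta> / 2 into
  \<delta>.\<close>

lemma perturbed_step_decrease:
  fixes x y z a c q :: "'a::real_normed_vector"
  assumes z: "z = (1 - \<alpha>) *\<^sub>R x + \<alpha> *\<^sub>R (y - a)"
    and \<alpha>: "0 \<le> \<alpha>" "\<alpha> < 1"
    and j: "j \<in> duality_map (z - q)" "blinfun_apply j c \<ge> \<delta>"
    and "\<delta> \<ge> 0"
    and err: "norm (z - q) * (norm (y - z) + norm (a - c)) \<le> \<delta> / 2"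
  shows "(norm (z - q))\<^sup>2 \<le> (norm (x - q))\<^sup>2 - \<alpha> * \<delta>"
proof -
  let ?d = "norm (x - q)" and ?e = "norm (z - q)"
  \<comment> \<open>An implicit form: \<open>z - q\<close> also stays on the right, since
    \<open>j\<close> belongs to \<open>z - q\<close> and its value there is exactly the squared
    norm.\<close>
  have split: "z - q = (1 - \<alpha>) *\<^sub>R (x - q) + \<alpha> *\<^sub>R ((z - q) + (y - z) + (c - a) - c)"
    by (subst (1) z) (simp add: algebra_simps)
  have jz: "blinfun_apply j (z - q) = ?e\<^sup>2"
    using j by (simp add: duality_map_def)
  have "?e\<^sup>2 = (1 - \<alpha>) * blinfun_apply j (x - q)
      + \<alpha> * (?e\<^sup>2 + blinfun_apply j (y - z) + blinfun_apply j (c - a) - blinfun_apply j c)"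
    using arg_cong[OF split, of "blinfun_apply j"]
    unfolding blinfun.add_right blinfun.scaleR_right blinfun.diff_right[of j _ c] jz
      real_scaleR_def
    by (simp only: blinfun.add_right blinfun.diff_right)
  also have "\<dots> \<le> (1 - \<alpha>) * (?e * ?d) + \<alpha> * (?e\<^sup>2 + \<delta> / 2 - \<delta>)"
  proof (intro add_mono mult_left_mono)
    show "blinfun_apply j (x - q) \<le> ?e * ?d"
      by (rule duality_map_apply_le[OF j(1)])
    show "?e\<^sup>2 + blinfun_apply j (y - z) + blinfun_apply j (c - a) - blinfun_apply j c
        \<le> ?e\<^sup>2 + \<delta> / 2 - \<delta>"
      using duality_map_apply_le[OF j(1), of "y - z"] duality_map_apply_le[OF j(1), of "c - a"]
        j(2) err
      by (simp add: distrib_left norm_minus_commute)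
  qed (use \<alpha> in auto)
  also have "\<dots> \<le> (1 - \<alpha>) * ((?e\<^sup>2 + ?d\<^sup>2) / 2) + \<alpha> * (?e\<^sup>2 + \<delta> / 2 - \<delta>)"
    using \<alpha> sum_squares_bound[of ?e ?d] by (intro add_right_mono mult_left_mono) auto
  finally have "(1 - \<alpha>) * (?e\<^sup>2 - ?d\<^sup>2) \<le> - (\<alpha> * \<delta>)"
    by (simp add: field_simps)
  \<comment> \<open>Weakening by the factor \<open>1 - \<alpha>\<close> lets this positive factor
    cancel on both sides.\<close>
  also have "\<dots> \<le> (1 - \<alpha>) * - (\<alpha> * \<delta>)"
    using \<alpha> \<open>\<delta> \<ge> 0\<close> by (simp add: left_diff_distrib)
  finally have "?e\<^sup>2 - ?d\<^sup>2 \<le> - (\<alpha> * \<delta>)"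
    using \<alpha> by (simp only: mult_le_cancel_left_pos diff_gt_0_iff_gt)
  then show ?thesis
    by simp
qed

text \<open>If \<open>d n\<close> exceeded \<epsilon>, so would every \<open>d k\<close> from
  \<open>N\<close> to \<open>Suc m\<close>. The step inequalities then telescope, and the total
  decrease of at least \<open>K\<^sup>2\<close> would make a square negative.\<close>

lemma le_after_divergent_decrease:
  fixes d \<alpha> :: "nat \<Rightarrow> real"
  assumes d: "\<And>n. 0 \<le> d n"
    and \<alpha>: "\<And>n. 0 \<le> \<alpha> n"
    and \<epsilon>: "0 < \<epsilon>" and \<delta>: "0 < \<delta>"
    and step: "\<And>n. n \<ge> N \<Longrightarrow> d (Suc n) > \<epsilon> \<Longrightarrow> (d (Suc n))\<^sup>2 \<le> (d n)\<^sup>2 - \<alpha> n * \<delta>"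
    and dN: "d N < K"
    and sum: "(\<Sum>i=N..m. \<alpha> i) \<ge> K\<^sup>2 / \<delta>"
    and n: "n > m"
  shows "d n \<le> \<epsilon>"
proof -
  have "K > 0"
    using d[of N] dN by simp
  \<comment> \<open>A positive sum excludes the empty range \<open>m < N\<close>, so the induction
    up to \<open>m\<close> can start at \<open>N\<close>.\<close>
  then have "(\<Sum>i=N..m. \<alpha> i) > 0"
    using sum \<delta> by (meson divide_pos_pos less_le_trans zero_less_power)
  then have "N \<le> m"
    by (cases "N \<le> m") auto
  have stay: "d n \<le> \<epsilon>" if "k \<le> n" "N \<le> k" "d k \<le> \<epsilon>" for k n
    using that(1)
  proof (induction n rule: dec_induct)
    case base
    show ?case by (rule that(3))
  next
    case (step n)
    show ?case
    proof (rule ccontr)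
      assume gt: "\<not> d (Suc n) \<le> \<epsilon>"
      have "(d (Suc n))\<^sup>2 \<le> (d n)\<^sup>2 - \<alpha> n * \<delta>"
        using assms(5)[of n] gt step.hyps that(2) by simp
      also have "\<dots> \<le> (d n)\<^sup>2"
        using \<alpha>[of n] \<delta> by simp
      finally have "d (Suc n) \<le> d n"
        using d by (meson power2_le_imp_le)
      with gt step.IH show False by simp
    qed
  qed
  show ?thesis
  proof (rule ccontr)
    assume "\<not> d n \<le> \<epsilon>"
    \<comment> \<open>Contrapositive of \<open>stay\<close>; the bound \<open>Suc m\<close> is
      admissible because \<open>n > m\<close>.\<close>
    then have large: "d k > \<epsilon>" if "N \<le> k" "k \<le> Suc m" for k
      using stay[of k n] that n by force
    have "(d (Suc k))\<^sup>2 \<le> (d N)\<^sup>2 - (\<Sum>i=N..k. \<alpha> i) * \<delta>" if "N \<le> k" "k \<le> m" for k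
      using that
    proof (induction k rule: dec_induct)
      case base
      then show ?case using step[of N] large[of "Suc N"] by simp
    next
      case (step k)
      then show ?case
        using assms(5)[of "Suc k"] large[of "Suc (Suc k)"] by (simp add: distrib_right)
    qed
    from this[OF \<open>N \<le> m\<close>] have "(d (Suc m))\<^sup>2 \<le> (d N)\<^sup>2 - (\<Sum>i=N..m. \<alpha> i) * \<delta>"
      by simp
    also have "\<dots> \<le> (d N)\<^sup>2 - K\<^sup>2"
      using sum \<delta> by (simp add: pos_divide_le_eq)
    also have "\<dots> < 0"
      using d[of N] dN by (simp add: power_strict_mono)
    finally show False
      by (simp add: not_less[symmetric])
  qed
qed

lemma norm_convex_diff_less:
  fixes a b q :: "'a::real_normed_vector"
  assumes "norm (a - q) < K" "norm (b - q) < K" "0 \<le> t" "t < 1"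
  shows "norm ((1 - t) *\<^sub>R a + t *\<^sub>R b - q) < K"
  using convexD_alt[OF convex_ball, of a q K b t] assms by (simp add: dist_norm norm_minus_commute)

lemma tendsto_0_of_rate_of_convergence:
  assumes "rate_of_convergence \<Phi> a" "\<And>n. 0 \<le> a n"
  shows "a \<longlonglongrightarrow> 0"
proof (rule LIMSEQ_I)
  fix e :: real
  assume "0 < e"
  \<comment> \<open>A rate gives only a weak inequality, hence the half.\<close>
  then have "\<forall>n\<ge>\<Phi> (e / 2). a n \<le> e / 2"
    using assms(1) half_gt_zero unfolding rate_of_convergence_def by blast
  then show "\<exists>n0. \<forall>n\<ge>n0. norm (a n - 0) < e"
    using \<open>0 < e\<close> assms(2) by (intro exI[of _ "\<Phi> (e / 2)"]) fastforce
qed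

theorem theorem6p6:
  fixes A :: "'a::banach \<Rightarrow> 'a set"
    and q :: 'a
    and \<Theta> :: "real \<Rightarrow> real \<Rightarrow> real"
    and \<omega> :: "real \<Rightarrow> real"
    and \<alpha> \<beta> :: "nat \<Rightarrow> real"
    and \<phi> :: "real \<Rightarrow> nat"
    and r :: "nat \<Rightarrow> real \<Rightarrow> nat"
    and x y u v :: "nat \<Rightarrow> 'a"
    and K\<^sub>0 K\<^sub>1 :: real
  assumes "0 \<in> A q"
    and "uniformly_accretive_at_zero A q"
    and "modulus_accretivity_at_zero \<Theta> A q"
    and "modulus_uniform_continuity \<omega> A"
    and "bounded (op_range (id_minus A))"
    and "\<And>n. \<alpha> n \<in> {0..<1/2}"
    and "\<And>n. \<beta> n \<in> {0..<1/2}"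
    and "\<alpha> \<longlonglongrightarrow> 0"
    and "\<beta> \<longlonglongrightarrow> 0"
    and "joint_rate_of_convergence \<phi> \<alpha> \<beta>"
    and "filterlim (\<lambda>n. \<Sum>i\<le>n. \<alpha> i) at_top sequentially"
    and "rate_of_divergence r \<alpha>"
    and "\<And>n. x n \<in> op_domain A"
    and "\<And>n. y n \<in> op_domain A"
    and "\<And>n. x (Suc n) = (1 - \<alpha> n) *\<^sub>R x n + \<alpha> n *\<^sub>R u n"
    and "\<And>n. u n \<in> id_minus A (y n)"
    and "\<And>n. y n = (1 - \<beta> n) *\<^sub>R x n + \<beta> n *\<^sub>R v n"
    and "\<And>n. v n \<in> id_minus A (x n)"
    and "K\<^sub>0 > 0"
    and "K\<^sub>1 > 0"
    and "\<And>w. w \<in> op_range (id_minus A) \<Longrightarrow> norm w < K\<^sub>0"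
    and "norm (x 0 - q) < K\<^sub>1"
  shows "(\<lambda>n. norm (x n - q)) \<longlonglongrightarrow> 0 \<and>
         rate_of_convergence (Phi_rate \<Theta> \<omega> \<phi> r K\<^sub>0 K\<^sub>1) (\<lambda>n. norm (x n - q))"
proof -
  \<comment> \<open>\<open>2 * K\<^sub>0\<close> bounds the distance from \<open>q\<close> to the
    range of \<open>I - A\<close>, and \<open>K\<^sub>1\<close> the initial distance; the ball of
    radius \<open>K\<close> about \<open>q\<close> contains both.\<close>
  define K where "K = 2 * K\<^sub>0 + K\<^sub>1"
  have "K > 0"
    using assms(19,20) by (simp add: K_def)
  have range: "norm (w - q) < 2 * K\<^sub>0" if "w \<in> id_minus A z" for w z
  proof -
    \<comment> \<open>Here \<open>q = q - 0\<close> with \<open>0 \<in> A q\<close>.\<close>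
    have "q \<in> op_range (id_minus A)"
      using assms(1) by (force simp: op_range_def id_minus_def)
    then have "norm q < K\<^sub>0"
      by (rule assms(21))
    moreover have "norm w < K\<^sub>0"
      using that by (intro assms(21)) (auto simp: op_range_def)
    ultimately show ?thesis
      using norm_triangle_ineq4[of w q] by simp
  qed
  have u: "norm (u n - q) < K" and v: "norm (v n - q) < K" for n
    using range[OF assms(16)[of n]] range[OF assms(18)[of n]] assms(20) by (simp_all add: K_def)
  have \<alpha>: "0 \<le> \<alpha> n" "\<alpha> n < 1" and \<beta>: "0 \<le> \<beta> n" "\<beta> n < 1" for n
    using assms(6,7)[of n] by auto
  have x: "norm (x n - q) < K" for n
  proof (induction n)
    case 0
    show ?case using assms(19,22) by (simp add: K_def)
  next
    case (Suc n)
    show ?case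
      using norm_convex_diff_less[OF Suc u \<alpha>, of n n] by (simp add: assms(15))
  qed
  \<comment> \<open>Both points arise from \<open>x n\<close> by moving a fraction \<beta> or
    \<alpha> towards another point of the same ball, whose diameter is \<open>2 * K\<close>.\<close>
  have near: "norm (y n - x (Suc n)) \<le> 2 * K * (\<alpha> n + \<beta> n)" for n
  proof -
    have "norm (v n - x n) \<le> 2 * K" "norm (x n - u n) \<le> 2 * K"
      using norm_triangle_ineq4[of "v n - q" "x n - q"] norm_triangle_ineq4[of "x n - q" "u n - q"]
        u[of n] v[of n] x[of n] by simp_all
    then have "norm (\<beta> n *\<^sub>R (v n - x n)) \<le> \<beta> n * (2 * K)"
      "norm (\<alpha> n *\<^sub>R (x n - u n)) \<le> \<alpha> n * (2 * K)"
      using \<alpha>[of n] \<beta>[of n] by (simp_all add: mult_left_mono)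
    moreover have "y n - x (Suc n) = \<beta> n *\<^sub>R (v n - x n) + \<alpha> n *\<^sub>R (x n - u n)"
      by (simp add: assms(15,17) algebra_simps)
    ultimately have "norm (y n - x (Suc n)) \<le> \<beta> n * (2 * K) + \<alpha> n * (2 * K)"
      by (simp only: norm_triangle_mono)
    then show ?thesis
      by (simp add: algebra_simps)
  qed
  have rate: "norm (x n - q) \<le> \<epsilon>" if "0 < \<epsilon>" and n: "Phi_rate \<Theta> \<omega> \<phi> r K\<^sub>0 K\<^sub>1 \<epsilon> \<le> n" for \<epsilon> n
  proof -
    define \<delta> where "\<delta> = \<Theta> K \<epsilon>"
    \<comment> \<open>Each of the two errors will be at most \<eta>, so together they cost at most
      \<open>2 * K * \<eta> = \<delta> / 8\<close>, within the allowed \<delta> / 2.\<close>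
    define \<eta> where "\<eta> = \<delta> / (16 * K)"
    \<comment> \<open>The factor 1 / (6K) turns the bound
      \<open>2 * K * (\<alpha> k + \<beta> k) \<le> 4 * K * \<mu>\<close> into 2/3 of the minimum.
      Its entry \<eta> controls the distance of the points, its entry \<open>\<omega> \<eta>\<close>
      that of the operator values.\<close>
    define \<mu> where "\<mu> = min (1 / 4) (1 / (6 * K) * min \<eta> (\<omega> \<eta>))"
    define N where "N = \<phi> \<mu>"
    have "\<delta> > 0" and acc: "accretivity_bound A q \<epsilon> K \<delta>"
      using assms(3) \<open>0 < \<epsilon>\<close> \<open>K > 0\<close> by (auto simp: modulus_accretivity_at_zero_def \<delta>_def)
    have "\<eta> > 0"
      using \<open>\<delta> > 0\<close> \<open>K > 0\<close> by (simp add: \<eta>_def)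
    have "\<omega> \<eta> > 0"
      and cont: "\<And>z z'. z \<in> op_domain A \<Longrightarrow> z' \<in> op_domain A \<Longrightarrow> norm (z - z') \<le> \<omega> \<eta> \<Longrightarrow>
        Hstar (A z) (A z') \<eta>"
      using assms(4) \<open>\<eta> > 0\<close> by (auto simp: modulus_uniform_continuity_def)
    have "\<mu> > 0"
      using \<open>K > 0\<close> \<open>\<eta> > 0\<close> \<open>\<omega> \<eta> > 0\<close> by (simp add: \<mu>_def)
    have close: "norm (y k - x (Suc k)) \<le> min \<eta> (\<omega> \<eta>)" if "k \<ge> N" for k
    proof -
      have "\<alpha> k \<le> \<mu>" "\<beta> k \<le> \<mu>"
        using assms(10) \<open>\<mu> > 0\<close> that
        by (auto simp: joint_rate_of_convergence_def rate_of_convergence_def N_def)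
      moreover have "\<mu> \<le> 1 / (6 * K) * min \<eta> (\<omega> \<eta>)"
        by (simp add: \<mu>_def)
      ultimately have "\<alpha> k + \<beta> k \<le> 2 * (1 / (6 * K) * min \<eta> (\<omega> \<eta>))"
        by linarith
      then have "2 * K * (\<alpha> k + \<beta> k) \<le> 2 * K * (2 * (1 / (6 * K) * min \<eta> (\<omega> \<eta>)))"
        using \<open>K > 0\<close> by (intro mult_left_mono) auto
      also have "\<dots> = 2 / 3 * min \<eta> (\<omega> \<eta>)"
        using \<open>K > 0\<close> by simp
      also have "\<dots> \<le> min \<eta> (\<omega> \<eta>)"
        using \<open>\<eta> > 0\<close> \<open>\<omega> \<eta> > 0\<close> by linarith
      finally show ?thesis
        using near[of k] by (rule order_trans[rotated])
    qed
    have step: "(norm (x (Suc k) - q))\<^sup>2 \<le> (norm (x k - q))\<^sup>2 - \<alpha> k * \<delta>"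
      if k: "k \<ge> N" "norm (x (Suc k) - q) > \<epsilon>" for k
    proof -
      obtain a where a: "a \<in> A (y k)" "u k = y k - a"
        using assms(16)[of k] by (auto simp: id_minus_def)
      have "Hstar (A (y k)) (A (x (Suc k))) \<eta>"
        using cont[OF assms(14) assms(13)] close[OF k(1)] by simp
      \<comment> \<open>The scheme supplies \<open>a\<close> at \<open>y k\<close>, while
        accretivity is tested at \<open>x (Suc k)\<close>; \<open>c\<close> carries the value
        over.\<close>
      then obtain c where c: "c \<in> A (x (Suc k))" "norm (a - c) \<le> \<eta>"
        using a(1) by (auto simp: Hstar_def)
      have "norm (x (Suc k) - q) \<in> {\<epsilon>..K}"
        using k(2) x[of "Suc k"] by simp
      then obtain j where j: "j \<in> duality_map (x (Suc k) - q)" "blinfun_apply j c \<ge> \<delta>"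
        using acc c(1) unfolding accretivity_bound_def by blast
      have "norm (x (Suc k) - q) * (norm (y k - x (Suc k)) + norm (a - c)) \<le> K * (\<eta> + \<eta>)"
        using x[of "Suc k"] close[OF k(1)] c(2) \<open>K > 0\<close> by (intro mult_mono) auto
      also have "\<dots> \<le> \<delta> / 2"
        using \<open>K > 0\<close> \<open>\<delta> > 0\<close> by (simp add: \<eta>_def)
      finally show ?thesis
        using assms(15)[of k] \<alpha> j \<open>\<delta> > 0\<close>
        by (intro perturbed_step_decrease[where c = c and j = j and y = "y k" and a = a])
          (auto simp: a(2))
    qed
    have "(\<Sum>i=N..r N (K\<^sup>2 / \<delta>). \<alpha> i) \<ge> K\<^sup>2 / \<delta>"
      using assms(12) \<open>K > 0\<close> \<open>\<delta> > 0\<close> by (simp add: rate_of_divergence_def)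
    \<comment> \<open>The summand \<open>+ 1\<close> in the rate gives strictness: the decrease
      weighted by \<alpha> at the last index of the sum takes effect only at the next
      iterate.\<close>
    moreover have "n > r N (K\<^sup>2 / \<delta>)"
      using n by (simp add: Phi_rate_def Let_def K_def N_def \<mu>_def \<eta>_def \<delta>_def)
    ultimately show ?thesis
      using le_after_divergent_decrease[of "\<lambda>n. norm (x n - q)" \<alpha> \<epsilon> \<delta> N K "r N (K\<^sup>2 / \<delta>)" n]
        \<alpha>(1) \<open>0 < \<epsilon>\<close> \<open>\<delta> > 0\<close> step x
      by simp
  qed
  have "rate_of_convergence (Phi_rate \<Theta> \<omega> \<phi> r K\<^sub>0 K\<^sub>1) (\<lambda>n. norm (x n - q))"
    unfolding rate_of_convergence_def using rate by blast
  then show ?thesis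
    using tendsto_0_of_rate_of_convergence by force
qed

end
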